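(* Let $n,k,t$ be integers with $0\le k\le n-1$, and let $R=\lfloor\frac{n-k-1}{2}\rfloor$. Suppose there exists an $(n,2^t,R)$ covering code. Then $\mathrm{D_{cc}^{\rightarrow}}(F_k)\le t$, where $F_k(x,y)=f_k(x\oplus y)$ and $f_k\colon\{0,1\}^n\to\{0,1,\perp\}$ is given by $f_k(x)=0$ if $|x|\le k$, $f_k(x)=\perp$ if $k+1\le|x|\le n-1$, $f_k(x)=1$ if $|x|=n$.
   Context: $|x|$ is Hamming weight and $\operatorname{dist}$ Hamming distance. A set $\mathcal C\subseteq\{0,1\}^n$ is an $(n,K,R)$ covering code if $|\mathcal C|\le K$ and every $x\in\{0,1\}^n$ has some $c\in\mathcal C$ with $\operatorname{dist}(x,c)\le R$. For a partial $f$, $\operatorname{Dom}(f)=f^{-1}(\{0,1\})$, $\oplus$ is bitwise XOR, and $F(x,y)=f(x\oplus y)$ with $\operatorname{Dom}(F)=\{(x,y):x\oplus y\in\operatorname{Dom}(f)\}$. A one-way protocol of cost $t$ for $F$ consists of total functions $h\colon\{0,1\}^n\to\{0,1\}^t$ and $\varphi\colon\{0,1\}^t\times\{0,1\}^n\to\{0,1\}$ with $\varphi(h(x),y)=F(x,y)$ for all $(x,y)\in\operatorname{Dom}(F)$; $\mathrm{D_{cc}^{\rightarrow}}(F)$ is the minimum such $t$. *)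

theory Defs
  imports Main "HOL-Library.FuncSet"
begin

definition cube :: "nat \<Rightarrow> bool list set" where
  "cube n = {x. length x = n}"

definition hweight :: "bool list \<Rightarrow> nat" where
  "hweight x = card {i. i < length x \<and> x ! i}"

text \<open>Only meaningful for lists of equal length.\<close>

definition hdist :: "bool list \<Rightarrow> bool list \<Rightarrow> nat" where
  "hdist x y = card {i. i < length x \<and> x ! i \<noteq> y ! i}"

definition bxor :: "bool list \<Rightarrow> bool list \<Rightarrow> bool list" where
  "bxor x y = map2 (\<noteq>) x y"

definition covering_code :: "nat \<Rightarrow> nat \<Rightarrow> nat \<Rightarrow> bool list set \<Rightarrow> bool" where
  "covering_code n K R C \<longleftrightarrow>
     C \<subseteq> cube n \<and> card C \<le> K \<and> (\<forall>x\<in>cube n. \<exists>c\<in>C. hdist x c \<le> R)"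

text \<open>Partial Boolean functions are maps into \<^typ>\<open>bool option\<close>, with \<^const>\<open>None\<close> for
  \<open>\<bottom>\<close>, \<^term>\<open>Some False\<close> for 0 and \<^term>\<open>Some True\<close> for 1.\<close>

definition xor_fun ::
  "nat \<Rightarrow> (bool list \<Rightarrow> bool option) \<Rightarrow> (bool list \<times> bool list \<Rightarrow> bool option)" where
  "xor_fun n f = (\<lambda>(x, y). if x \<in> cube n \<and> y \<in> cube n then f (bxor x y) else None)"

definition one_way_protocol ::
  "nat \<Rightarrow> (bool list \<times> bool list \<Rightarrow> bool option) \<Rightarrow> nat \<Rightarrow>
   (bool list \<Rightarrow> bool list) \<Rightarrow> (bool list \<times> bool list \<Rightarrow> bool) \<Rightarrow> bool" where
  "one_way_protocol n F t h \<phi> \<longleftrightarrow>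
     h \<in> cube n \<rightarrow> cube t \<and>
     (\<forall>x\<in>cube n. \<forall>y\<in>cube n. (x, y) \<in> dom F \<longrightarrow> F (x, y) = Some (\<phi> (h x, y)))"

definition Dcc_one_way :: "nat \<Rightarrow> (bool list \<times> bool list \<Rightarrow> bool option) \<Rightarrow> nat" where
  "Dcc_one_way n F = (LEAST t. \<exists>h \<phi>. one_way_protocol n F t h \<phi>)"

text \<open>The minimum is attained: sending the whole input is a protocol of cost \<open>n\<close>.\<close>

lemma one_way_protocol_trivial: "one_way_protocol n F n (\<lambda>x. x) (\<lambda>p. the (F p))"
  by (auto simp: one_way_protocol_def)

definition f_thr :: "nat \<Rightarrow> nat \<Rightarrow> bool list \<Rightarrow> bool option" where
  "f_thr n k x =
     (if x \<notin> cube n then None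
      else if hweight x \<le> k then Some False
      else if hweight x = n then Some True
      else None)"

end

theory Submission
  imports Defs
begin

text \<open>Alice sends the index of a codeword \<open>c\<close> within distance \<open>R\<close> of \<open>x\<close>. By the triangle
  inequality, \<open>dist(c, y) \<le> R + k\<close> if \<open>|x \<oplus> y| \<le> k\<close>, whereas \<open>dist(c, y) \<ge> n - R\<close> if
  \<open>|x \<oplus> y| = n\<close>. As \<open>2 R < n - k\<close>, Bob can tell the two cases apart by comparing
  \<open>dist(c, y)\<close> with \<open>R + k\<close>.\<close>

lemma finite_cube: "finite (cube n)"
  and card_cube: "card (cube n) = 2 ^ n"
  using finite_lists_length_eq[of "UNIV :: bool set" n] card_lists_length_eq[of "UNIV :: bool set" n]
  by (simp_all add: cube_def)

lemma hweight_bxor: "length x = length y \<Longrightarrow> hweight (bxor x y) = hdist x y"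
  by (auto simp: hweight_def hdist_def bxor_def intro!: arg_cong[where f = card])

lemma hdist_commute: "length x = length y \<Longrightarrow> hdist x y = hdist y x"
  by (auto simp: hdist_def intro!: arg_cong[where f = card])

text \<open>Where \<open>x\<close> and \<open>z\<close> differ, \<open>y\<close> differs from one of
  them. Since \<open>hdist\<close> ranges over the positions of its first argument, \<open>x\<close>
  and \<open>y\<close> must have the same length.\<close>

lemma hdist_triangle:
  assumes "length x = length y"
  shows "hdist x z \<le> hdist x y + hdist y z"
proof -
  have "hdist x z \<le> card ({i. i < length x \<and> x ! i \<noteq> y ! i} \<union> {i. i < length y \<and> y ! i \<noteq> z ! i})"
    unfolding hdist_def using assms by (intro card_mono) auto
  also have "\<dots> \<le> hdist x y + hdist y z"
    unfolding hdist_def by (rule card_Un_le)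
  finally show ?thesis .
qed

lemma one_way_protocol_of_covering_code:
  assumes code: "covering_code n (2 ^ t) R C" and gap: "2 * R + k < n"
  shows "\<exists>h \<phi>. one_way_protocol n (xor_fun n (f_thr n k)) t h \<phi>"
proof -
  have C: "C \<subseteq> cube n" "card C \<le> card (cube t)"
    using code by (auto simp: covering_code_def card_cube)
  then obtain enc where enc: "enc ` C \<subseteq> cube t" "inj_on enc C"
    using card_le_inj[of C "cube t"] finite_subset[OF _ finite_cube] finite_cube by blast
  obtain near where near: "\<And>x. x \<in> cube n \<Longrightarrow> near x \<in> C \<and> hdist x (near x) \<le> R"
    using code unfolding covering_code_def by metis
  \<comment> \<open>Off the image of \<open>C\<close> under \<open>enc\<close> the decoded word is
    unspecified, but Bob only receives encodings of codewords.\<close>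
  define \<phi> where "\<phi> = (\<lambda>(m, y). R + k < hdist (inv_into C enc m) y)"
  have "f_thr n k (bxor x y) = Some (\<phi> (enc (near x), y))"
    if x: "x \<in> cube n" and y: "y \<in> cube n" and dom: "f_thr n k (bxor x y) \<noteq> None" for x y
  proof -
    have len: "length x = n" "length y = n" "length (near x) = n"
      using x y near[OF x] C(1) by (auto simp: cube_def)
    have \<phi>: "\<phi> (enc (near x), y) \<longleftrightarrow> R + k < hdist (near x) y"
      using near[OF x] enc(2) by (simp add: \<phi>_def)
    \<comment> \<open>This bound settles the value 0; the reverse one below settles the value 1,
      where \<open>n - R > R + k\<close> by \<open>gap\<close>.\<close>
    have "hdist (near x) y \<le> R + hdist x y"
      using hdist_triangle[of "near x" x y] hdist_commute[of x "near x"] near[OF x] len by simp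
    moreover have "hdist x y \<le> R + hdist (near x) y"
      using hdist_triangle[of x "near x" y] near[OF x] len by simp
    ultimately show ?thesis
      using dom gap hweight_bxor[of x y] len unfolding f_thr_def \<phi>
      by (auto split: if_splits)
  qed
  then have "one_way_protocol n (xor_fun n (f_thr n k)) t (enc \<circ> near) \<phi>"
    using near enc(1) by (fastforce simp: one_way_protocol_def xor_fun_def)
  then show ?thesis by blast
qed

theorem theorem28:
  fixes n k t R :: nat
  assumes "k < n"
    and "R = (n - k - 1) div 2"
    and "\<exists>C. covering_code n (2 ^ t) R C"
  shows "Dcc_one_way n (xor_fun n (f_thr n k)) \<le> t"
proof -
  \<comment> \<open>Rounding down gives \<open>2 * R \<le> n - k - 1\<close>, and
    \<open>k < n\<close> keeps this subtraction from being truncated.\<close>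
  have "2 * R + k < n"
    using assms(1,2) by linarith
  then show ?thesis
    unfolding Dcc_one_way_def
    using assms(3) one_way_protocol_of_covering_code by (blast intro: Least_le)
qed

end
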